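(* Let $N\in\mathbb{N}$, let $\lambda_{ij}\ge0$ for $i,j\in[N]$, $i\ne j$, satisfy componentwise strong connectivity with vertex sets $S_1,\dots,S_m$ (see context). Let $T>0$ and let $K:\mathbb{R}^d\to\mathbb{R}$ be a bounded continuous function with $K(x)=K(-x)$ for all $x$ and $K\not\equiv0$. For $p\in(0,\infty)^N$ let $$\alpha(p):=T\|K\|_{L^\infty}\max_{i\in[N]}\frac1{p_i}\sum_{j\ne i}|p_i\lambda_{ij}-p_j\lambda_{ji}|,$$ and let $$r^\star:=\inf_{p\in(0,\infty)^N}\max_{i\in[N]}\frac1{p_i}\sum_{j\ne i}|p_i\lambda_{ij}-p_j\lambda_{ji}|,\quad \alpha^\star:=T\|K\|_{L^\infty}r^\star,\quad r_0:=\max_{i\in[N]}\sum_{j\ne i}|\lambda_{ij}-\lambda_{ji}|.$$ Let $(p^n,r^n)$ denote the output after $n$ iterations of the bisection algorithm described in the context. Then $$0\le r^n-r^\star\le\frac{r_0}{2^n},\qquad 0\le\alpha(p^n)-\alpha^\star\le T\|K\|_{L^\infty}\frac{r_0}{2^n}.$$ Consequently, $r^n$ converges to $r^\star$ and $\alpha(p^n)$ converges to $\alpha^\star$ at the rate $O(2^{-n})$.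
   Context: $[N]=\{1,\dots,N\}$; $\|K\|_{L^\infty}$ is the sup norm. Directed interaction graph: $\mathcal G_\lambda=([N],E_\lambda)$ has a directed edge $j\to i$ ($i\ne j$) if and only if $\lambda_{ij}>0$. Componentwise strong connectivity: $\mathcal G_\lambda$ can be decomposed into a disjoint union of strongly connected subgraphs with (nonempty, pairwise disjoint) vertex sets $S_1,\dots,S_m$, that is, $[N]=S_1\cup\cdots\cup S_m$, each subgraph induced by $S_k$ is strongly connected (for any two of its vertices $i,j$ there is a directed path from $i$ to $j$ within the subgraph; a single vertex is strongly connected), and $\lambda_{ij}=\lambda_{ji}=0$ for all $i\in S_k$, $j\in S_\ell$, $k\ne\ell$. Bisection algorithm (input: $(\lambda_{ij})$, $S_1,\dots,S_m$, number of iterations $n$). Initialize $r_{\rm low}=0$, $r_{\rm high}=r_0$, $p=(1,\dots,1)$. Repeat $n$ times: set $r_{\rm mid}=(r_{\rm low}+r_{\rm high})/2$ and check whether there exists $\tilde p\in[0,\infty)^N$ with $$\sum_{j\ne i}|\tilde p_i\lambda_{ij}-\tilde p_j\lambda_{ji}|\le r_{\rm mid}\,\tilde p_i\ (i\in[N]),\qquad \sum_{i\in S_\ell}\tilde p_i=|S_\ell|\ (\ell=1,\dots,m).$$ If feasible, set $r_{\rm high}=r_{\rm mid}$ and $p=\tilde p$ for some such $\tilde p$; otherwise set $r_{\rm low}=r_{\rm mid}$. Return $p$ and $r=r_{\rm high}$. *)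

theory Defs
  imports
    "HOL-Analysis.Analysis"
    "HOL-Library.Landau_Symbols"
    "Graph_Theory.Digraph_Component"
begin

text \<open>
  The index set is a finite type \<open>'n\<close>. The rates \<open>\<lambda>\<^sub>i\<^sub>j\<close> are given by \<open>lam i j\<close>; the
  diagonal values \<open>lam i i\<close> never matter.
\<close>

text \<open>A pair \<open>(j, i)\<close> is the arc with tail \<open>j\<close> and head \<open>i\<close>.\<close>

definition interaction_graph :: "('n \<Rightarrow> 'n \<Rightarrow> real) \<Rightarrow> 'n pair_pre_digraph" where
  "interaction_graph lam = \<lparr>pverts = UNIV, parcs = {(j, i). i \<noteq> j \<and> 0 < lam i j}\<rparr>"

definition componentwise_strongly_connected ::
    "('n \<Rightarrow> 'n \<Rightarrow> real) \<Rightarrow> nat \<Rightarrow> (nat \<Rightarrow> 'n set) \<Rightarrow> bool" where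
  "componentwise_strongly_connected lam m S \<longleftrightarrow>
     (\<Union>k\<in>{1..m}. S k) = UNIV \<and>
     (\<forall>k\<in>{1..m}. S k \<noteq> {}) \<and>
     disjoint_family_on S {1..m} \<and>
     (\<forall>k\<in>{1..m}. strongly_connected (with_proj (interaction_graph lam) \<restriction> S k)) \<and>
     (\<forall>k\<in>{1..m}. \<forall>l\<in>{1..m}. k \<noteq> l \<longrightarrow>
        (\<forall>i\<in>S k. \<forall>j\<in>S l. lam i j = 0 \<and> lam j i = 0))"

definition imbalance :: "('n::finite \<Rightarrow> 'n \<Rightarrow> real) \<Rightarrow> real ^ 'n \<Rightarrow> 'n \<Rightarrow> real" where
  "imbalance lam p i = (\<Sum>j\<in>UNIV - {i}. \<bar>p $ i * lam i j - p $ j * lam j i\<bar>)"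

text \<open>Only meaningful for \<open>p\<close> with positive components, since \<open>1 / 0 = 0\<close>.\<close>

definition max_rel_imbalance :: "('n::finite \<Rightarrow> 'n \<Rightarrow> real) \<Rightarrow> real ^ 'n \<Rightarrow> real" where
  "max_rel_imbalance lam p = (MAX i. 1 / p $ i * imbalance lam p i)"

definition r_star :: "('n::finite \<Rightarrow> 'n \<Rightarrow> real) \<Rightarrow> real" where
  "r_star lam = (INF p\<in>{p. \<forall>i. 0 < p $ i}. max_rel_imbalance lam p)"

definition r_zero :: "('n::finite \<Rightarrow> 'n \<Rightarrow> real) \<Rightarrow> real" where
  "r_zero lam = (MAX i. \<Sum>j\<in>UNIV - {i}. \<bar>lam i j - lam j i\<bar>)"

text \<open>The norm of a bounded continuous function is its sup norm.\<close>

definition alpha ::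
    "real \<Rightarrow> ((real ^ 'd) \<Rightarrow>\<^sub>C real) \<Rightarrow> ('n::finite \<Rightarrow> 'n \<Rightarrow> real) \<Rightarrow> real ^ 'n \<Rightarrow> real" where
  "alpha T K lam p = T * norm K * max_rel_imbalance lam p"

definition alpha_star ::
    "real \<Rightarrow> ((real ^ 'd) \<Rightarrow>\<^sub>C real) \<Rightarrow> ('n::finite \<Rightarrow> 'n \<Rightarrow> real) \<Rightarrow> real" where
  "alpha_star T K lam = T * norm K * r_star lam"

definition feasible ::
    "('n::finite \<Rightarrow> 'n \<Rightarrow> real) \<Rightarrow> nat \<Rightarrow> (nat \<Rightarrow> 'n set) \<Rightarrow> real \<Rightarrow> real ^ 'n \<Rightarrow> bool" where
  "feasible lam m S r q \<longleftrightarrow>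
     (\<forall>i. 0 \<le> q $ i) \<and>
     (\<forall>i. imbalance lam q i \<le> r * q $ i) \<and>
     (\<forall>l\<in>{1..m}. (\<Sum>i\<in>S l. q $ i) = real (card (S l)))"

text \<open>
  \<open>bisection lam m S n r_low r_high p\<close>: some run of the algorithm is in the state
  \<open>(r_low, r_high, p)\<close> after \<open>n\<close> iterations. It is a relation because the algorithm may pick any
  feasible point.
\<close>

inductive bisection ::
    "('n::finite \<Rightarrow> 'n \<Rightarrow> real) \<Rightarrow> nat \<Rightarrow> (nat \<Rightarrow> 'n set) \<Rightarrow>
     nat \<Rightarrow> real \<Rightarrow> real \<Rightarrow> real ^ 'n \<Rightarrow> bool"
  for lam m S where
  init: "bisection lam m S 0 0 (r_zero lam) (\<chi> i. 1)"
| step_feasible: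
    "\<lbrakk>bisection lam m S n r_low r_high p; r_mid = (r_low + r_high) / 2;
      feasible lam m S r_mid q\<rbrakk>
     \<Longrightarrow> bisection lam m S (Suc n) r_low r_mid q"
| step_infeasible:
    "\<lbrakk>bisection lam m S n r_low r_high p; r_mid = (r_low + r_high) / 2;
      \<nexists>q. feasible lam m S r_mid q\<rbrakk>
     \<Longrightarrow> bisection lam m S (Suc n) r_mid r_high p"

definition bisection_output ::
    "('n::finite \<Rightarrow> 'n \<Rightarrow> real) \<Rightarrow> nat \<Rightarrow> (nat \<Rightarrow> 'n set) \<Rightarrow>
     nat \<Rightarrow> real ^ 'n \<Rightarrow> real \<Rightarrow> bool" where
  "bisection_output lam m S n p r \<longleftrightarrow> (\<exists>r_low. bisection lam m S n r_low r p)"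

lemma bisection_output_exists: "\<exists>p r. bisection_output lam m S n p r"
proof -
  have "\<exists>r_low r p. bisection lam m S n r_low r p"
  proof (induction n)
    case 0
    show ?case using bisection.init by blast
  next
    case (Suc n)
    then obtain r_low r p where run: "bisection lam m S n r_low r p" by blast
    show ?case
    proof (cases "\<exists>q. feasible lam m S ((r_low + r) / 2) q")
      case True
      then obtain q where "feasible lam m S ((r_low + r) / 2) q" by blast
      from bisection.step_feasible[OF run refl this] show ?thesis by (intro exI)
    next
      case False
      from bisection.step_infeasible[OF run refl this] show ?thesis by (intro exI)
    qed
  qed
  then show ?thesis unfolding bisection_output_def by blast
qed

end

(*
  If a feasible point vanishes at i, its constraint at i forces it to vanish at every
  out-neighbour of i, hence on the whole component of i, contradicting the normalisation;
  so feasible points are positive. As the imbalance at i only involves the component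
  of i, rescaling a positive vector on each component does not change its relative imbalances,
  so r is feasible as soon as r_star < r. Hence r_low <= r_star <= max_rel_imbalance p <= r_high
  along the algorithm, while r_high - r_low is halved in each iteration.
*)
theory Submission
  imports Defs
begin

text \<open>Clearing the positive denominators turns a bound on the objective of
  \<open>r_star\<close> into the constraints of \<open>feasible\<close>.\<close>

lemma max_rel_imbalance_le_iff:
  assumes "\<And>i. 0 < p $ i"
  shows "max_rel_imbalance lam p \<le> r \<longleftrightarrow> (\<forall>i. imbalance lam p i \<le> r * p $ i)"
  using assms by (simp add: max_rel_imbalance_def pos_divide_le_eq)

lemma max_rel_imbalance_nonneg:
  fixes p :: "real ^ 'n"
  assumes "\<And>i. 0 < p $ i"
  shows "0 \<le> max_rel_imbalance lam p"
proof -
  fix i :: 'n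
  have "0 \<le> 1 / p $ i * imbalance lam p i"
    using assms[of i] by (simp add: imbalance_def sum_nonneg)
  also have "\<dots> \<le> max_rel_imbalance lam p"
    unfolding max_rel_imbalance_def by (rule Max_ge) auto
  finally show ?thesis .
qed

lemma r_star_le:
  assumes "\<And>i. 0 < p $ i"
  shows "r_star lam \<le> max_rel_imbalance lam p"
  unfolding r_star_def
proof (rule cINF_lower)
  show "bdd_below (max_rel_imbalance lam ` {p. \<forall>i. 0 < p $ i})"
    by (rule bdd_belowI2[where m = 0]) (auto intro: max_rel_imbalance_nonneg)
qed (use assms in simp)

lemma r_star_greatest:
  assumes "\<And>p. (\<And>i. 0 < p $ i) \<Longrightarrow> r \<le> max_rel_imbalance lam p"
  shows "r \<le> r_star lam"
  unfolding r_star_def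
proof (rule cINF_greatest)
  have "(\<chi> i. 1) \<in> {p :: real ^ 'a. \<forall>i. 0 < p $ i}" by simp
  then show "{p :: real ^ 'a. \<forall>i. 0 < p $ i} \<noteq> {}" by blast
qed (use assms in auto)

text \<open>Shows that the initial upper end of the bisection is the objective value of the initial
  vector.\<close>

lemma r_zero_eq: "r_zero lam = max_rel_imbalance lam (\<chi> i. 1)"
  by (simp add: r_zero_def max_rel_imbalance_def imbalance_def)

text \<open>When \<open>q $ i = 0\<close> the bound \<open>r * q $ i\<close> is zero, so each
  summand of the imbalance at \<open>i\<close> is zero; the one for \<open>j\<close> is then
  \<open>q $ j * lam j i\<close> up to sign.\<close>

lemma imbalance_vanishing_propagates:
  assumes "imbalance lam q i \<le> r * q $ i" "q $ i = 0" "j \<noteq> i" "0 < lam j i"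
  shows "q $ j = 0"
proof -
  have "\<bar>q $ i * lam i j - q $ j * lam j i\<bar> \<le> imbalance lam q i"
    unfolding imbalance_def using assms(3) by (intro member_le_sum) auto
  with assms have "\<bar>q $ j * lam j i\<bar> \<le> 0" by simp
  then show ?thesis using assms(4) by simp
qed

lemma vanishing_on_component:
  assumes imb: "\<And>i. imbalance lam q i \<le> r * q $ i"
    and sc: "strongly_connected (with_proj (interaction_graph lam) \<restriction> V)"
    and "i \<in> V" "j \<in> V" "q $ i = 0"
  shows "q $ j = 0"
proof -
  let ?G = "with_proj (interaction_graph lam) \<restriction> V"
  have "i \<rightarrow>\<^sup>*\<^bsub>?G\<^esub> j"
    using sc assms(3,4) by (simp add: strongly_connected_def)
  then have "(i, j) \<in> rtrancl_on (verts ?G) (arcs_ends ?G)"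
    by (simp add: reachable_def)
  then show ?thesis
    using assms(5)
  proof (induction rule: rtrancl_on.induct)
    case (rtrancl_on_into_rtrancl_on a u v)
    \<comment> \<open>An arc has its tail first, so \<open>(u, v)\<close> encodes a positive rate
      \<open>lam v u\<close>: zeros travel forward along the path.\<close>
    then have "v \<noteq> u" "0 < lam v u"
      by (auto simp: arcs_ends_def arc_to_ends_def interaction_graph_def)
    then show ?case
      using imbalance_vanishing_propagates imb rtrancl_on_into_rtrancl_on by blast
  qed simp
qed

text \<open>The algorithm only asks for nonnegative entries; strict positivity is what makes a
  feasible point a competitor in the infimum \<open>r_star\<close>.\<close>

lemma feasible_positive:
  assumes conn: "componentwise_strongly_connected lam m S"
    and feas: "feasible lam m S r q"
  shows "0 < q $ i"
proof (rule ccontr)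
  assume "\<not> 0 < q $ i"
  then have zero: "q $ i = 0"
    using feas by (metis feasible_def order_less_le)
  obtain k where k: "k \<in> {1..m}" "i \<in> S k"
    using conn unfolding componentwise_strongly_connected_def by blast
  have "q $ j = 0" if "j \<in> S k" for j
    using vanishing_on_component[OF _ _ k(2) that zero] conn feas k(1)
    unfolding componentwise_strongly_connected_def feasible_def by blast
  then have "(\<Sum>j\<in>S k. q $ j) = 0" by simp
  moreover have "(\<Sum>j\<in>S k. q $ j) = real (card (S k))"
    using feas k(1) unfolding feasible_def by blast
  \<comment> \<open>The finite set \<open>S k\<close> contains \<open>i\<close>, so its cardinality
    is not zero.\<close>
  ultimately show False using k(2) by auto
qed

lemma feasible_max_rel_imbalance_le:
  assumes "componentwise_strongly_connected lam m S" "feasible lam m S r q"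
  shows "max_rel_imbalance lam q \<le> r"
  using assms(2) feasible_positive[OF assms]
  by (simp add: max_rel_imbalance_le_iff feasible_def)

lemma feasible_exists:
  assumes conn: "componentwise_strongly_connected lam m S"
    and pos: "\<And>i. 0 < p $ i"
    and le: "max_rel_imbalance lam p \<le> r"
  shows "\<exists>q. feasible lam m S r q"
proof -
  have cover: "\<exists>k. k \<in> {1..m} \<and> i \<in> S k" for i
    using conn unfolding componentwise_strongly_connected_def by blast
  then obtain k where k: "\<And>i. k i \<in> {1..m}" "\<And>i. i \<in> S (k i)" by metis
  have k_unique: "k i = l" if "i \<in> S l" "l \<in> {1..m}" for i l
    using conn that k[of i]
    unfolding componentwise_strongly_connected_def disjoint_family_on_def by blast
  have cross: "lam i j = 0 \<and> lam j i = 0" if "k i \<noteq> k j" for i j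
    using conn that k unfolding componentwise_strongly_connected_def by blast
  \<comment> \<open>The factor by which \<open>p\<close> must be scaled on \<open>S l\<close> to
    meet the normalisation there; \<open>k i\<close> is the index of the component of
    \<open>i\<close>.\<close>
  define c where "c l = real (card (S l)) / (\<Sum>i\<in>S l. p $ i)" for l
  define q where "q = (\<chi> i. c (k i) * p $ i)"
  have c_nonneg: "0 \<le> c l" for l
    unfolding c_def using pos by (intro divide_nonneg_nonneg sum_nonneg) (auto intro: less_imp_le)
  \<comment> \<open>Within a component the common factor comes out of the summand; between
    components both rates are zero and so are both sides.\<close>
  have imb: "imbalance lam q i = c (k i) * imbalance lam p i" for i
    unfolding imbalance_def sum_distrib_left
  proof (rule sum.cong[OF refl])
    fix j
    show "\<bar>q $ i * lam i j - q $ j * lam j i\<bar> = c (k i) * \<bar>p $ i * lam i j - p $ j * lam j i\<bar>"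
    proof (cases "k i = k j")
      case True
      then have "q $ i * lam i j - q $ j * lam j i = c (k i) * (p $ i * lam i j - p $ j * lam j i)"
        by (simp add: q_def algebra_simps)
      then show ?thesis using c_nonneg by (simp add: abs_mult)
    next
      case False
      then show ?thesis using cross by simp
    qed
  qed
  have "feasible lam m S r q"
    unfolding feasible_def
  proof (intro conjI allI ballI)
    fix i
    show "0 \<le> q $ i" using c_nonneg pos[of i] by (simp add: q_def)
    have "imbalance lam p i \<le> r * p $ i"
      using le pos by (simp add: max_rel_imbalance_le_iff)
    from mult_left_mono[OF this c_nonneg[of "k i"]]
    show "imbalance lam q i \<le> r * q $ i" unfolding imb by (simp add: q_def mult.left_commute)
  next
    fix l assume l: "l \<in> {1..m}"
    have "S l \<noteq> {}" using conn l unfolding componentwise_strongly_connected_def by blast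
    \<comment> \<open>The denominator of \<open>c l\<close> is nonzero and cancels.\<close>
    then have "0 < (\<Sum>i\<in>S l. p $ i)" using pos by (intro sum_pos) auto
    moreover have "(\<Sum>i\<in>S l. q $ i) = c l * (\<Sum>i\<in>S l. p $ i)"
      unfolding sum_distrib_left by (rule sum.cong) (use k_unique l in \<open>auto simp: q_def\<close>)
    ultimately show "(\<Sum>i\<in>S l. q $ i) = real (card (S l))" by (simp add: c_def)
  qed
  then show ?thesis ..
qed

text \<open>A positive vector with objective at most \<open>r\<close> could be rescaled to a
  feasible point, so all objective values exceed \<open>r\<close>.\<close>

lemma infeasible_le_r_star:
  assumes "componentwise_strongly_connected lam m S" "\<nexists>q. feasible lam m S r q"
  shows "r \<le> r_star lam"
  using feasible_exists[OF assms(1)] assms(2) by (intro r_star_greatest) (meson linear)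

text \<open>The upper bound is on the objective at the current \<open>p\<close>, not merely on
  \<open>r_star\<close>, so that \<open>p\<close> itself is controlled. It survives an infeasible
  step because \<open>p\<close> and \<open>r_high\<close> are both kept.\<close>

lemma bisection_invariant:
  assumes conn: "componentwise_strongly_connected lam m S"
    and "bisection lam m S n r_low r_high p"
  shows "(\<forall>i. 0 < p $ i) \<and> r_low \<le> r_star lam \<and> max_rel_imbalance lam p \<le> r_high \<and>
         r_high - r_low = r_zero lam / 2 ^ n"
  using assms(2)
proof (induction rule: bisection.induct)
  case init
  show ?case
    by (simp add: r_zero_eq r_star_greatest max_rel_imbalance_nonneg)
next
  case (step_feasible n r_low r_high p r_mid q)
  from step_feasible.hyps have "r_mid - r_low = (r_high - r_low) / 2"
    by (simp add: field_simps)
  with step_feasible show ?case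
    using feasible_positive[OF conn] feasible_max_rel_imbalance_le[OF conn] by auto
next
  case (step_infeasible n r_low r_high p r_mid)
  from step_infeasible.hyps have "r_high - r_mid = (r_high - r_low) / 2"
    by (simp add: field_simps)
  with step_infeasible show ?case
    using infeasible_le_r_star[OF conn] by auto
qed

text \<open>The error is squeezed between 0 and a geometric sequence, and \<open>C\<close> also
  serves as the constant in the O-bound.\<close>

lemma geometric_error_convergence:
  fixes x :: "nat \<Rightarrow> real"
  assumes "\<And>n. 0 \<le> x n - L" "\<And>n. x n - L \<le> C / 2 ^ n"
  shows "x \<longlonglongrightarrow> L" "(\<lambda>n. x n - L) \<in> O(\<lambda>n. 1 / 2 ^ n)"
proof -
  have "(\<lambda>n. C / 2 ^ n) \<longlonglongrightarrow> 0"
    using LIMSEQ_divide_realpow_zero[of 2 C] by simp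
  then have "(\<lambda>n. x n - L) \<longlonglongrightarrow> 0"
    by (rule tendsto_sandwich[rotated 3]) (use assms in auto)
  then show "x \<longlonglongrightarrow> L" by (simp add: LIM_zero_iff)
  show "(\<lambda>n. x n - L) \<in> O(\<lambda>n. 1 / 2 ^ n)"
    by (rule bigoI[where c = C]) (use assms in auto)
qed

theorem proposition4p6:
  fixes lam :: "'n::finite \<Rightarrow> 'n \<Rightarrow> real"
    and m :: nat and S :: "nat \<Rightarrow> 'n set"
    and T :: real and K :: "(real ^ 'd) \<Rightarrow>\<^sub>C real"
    and pn :: "nat \<Rightarrow> real ^ 'n" and rn :: "nat \<Rightarrow> real"
  assumes lam_nonneg: "\<And>i j. i \<noteq> j \<Longrightarrow> 0 \<le> lam i j"
    and conn: "componentwise_strongly_connected lam m S"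
    and T_pos: "0 < T"
    and K_even: "\<And>x. K x = K (- x)"
    and K_nonzero: "\<exists>x. K x \<noteq> 0"
    and outputs: "\<And>n. bisection_output lam m S n (pn n) (rn n)"
  shows "(\<forall>n.
            (\<forall>i. 0 < pn n $ i) \<and>
            0 \<le> rn n - r_star lam \<and>
            rn n - r_star lam \<le> r_zero lam / 2 ^ n \<and>
            0 \<le> alpha T K lam (pn n) - alpha_star T K lam \<and>
            alpha T K lam (pn n) - alpha_star T K lam \<le> T * norm K * (r_zero lam / 2 ^ n)) \<and>
         rn \<longlonglongrightarrow> r_star lam \<and>
         (\<lambda>n. rn n - r_star lam) \<in> O(\<lambda>n. 1 / 2 ^ n) \<and>
         (\<lambda>n. alpha T K lam (pn n)) \<longlonglongrightarrow> alpha_star T K lam \<and>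
         (\<lambda>n. alpha T K lam (pn n) - alpha_star T K lam) \<in> O(\<lambda>n. 1 / 2 ^ n)"
proof -
  let ?c = "T * norm K"
  have c: "0 \<le> ?c" using T_pos by simp
  \<comment> \<open>Since \<open>r_low\<close> is at most \<open>r_star lam\<close>, the gap of the
    bisection bounds the distance from \<open>r_star lam\<close> to \<open>rn n\<close>. The
    objective at \<open>pn n\<close> lies between these two, so one bound serves both
    errors.\<close>
  have inv: "(\<forall>i. 0 < pn n $ i) \<and> r_star lam \<le> max_rel_imbalance lam (pn n) \<and>
      max_rel_imbalance lam (pn n) \<le> rn n \<and> rn n \<le> r_star lam + r_zero lam / 2 ^ n" for n
  proof -
    obtain r_low where "bisection lam m S n r_low (rn n) (pn n)"
      using outputs unfolding bisection_output_def by blast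
    from bisection_invariant[OF conn this] show ?thesis using r_star_le[of "pn n" lam] by auto
  qed
  have r: "0 \<le> rn n - r_star lam" "rn n - r_star lam \<le> r_zero lam / 2 ^ n" for n
    using inv[of n] by linarith+
  have a: "0 \<le> alpha T K lam (pn n) - alpha_star T K lam"
    "alpha T K lam (pn n) - alpha_star T K lam \<le> ?c * (r_zero lam / 2 ^ n)" for n
  proof -
    have eq: "alpha T K lam (pn n) - alpha_star T K lam
        = ?c * (max_rel_imbalance lam (pn n) - r_star lam)"
      by (simp add: alpha_def alpha_star_def right_diff_distrib)
    show "0 \<le> alpha T K lam (pn n) - alpha_star T K lam"
      unfolding eq using inv[of n] by (intro mult_nonneg_nonneg[OF c]) simp
    show "alpha T K lam (pn n) - alpha_star T K lam \<le> ?c * (r_zero lam / 2 ^ n)"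
      unfolding eq using inv[of n] by (intro mult_left_mono[OF _ c]) linarith
  qed
  \<comment> \<open>Regrouped to the shape \<open>C / 2 ^ n\<close> with
    \<open>C = ?c * r_zero lam\<close>.\<close>
  have a': "alpha T K lam (pn n) - alpha_star T K lam \<le> ?c * r_zero lam / 2 ^ n" for n
    using a(2)[of n] by simp
  show ?thesis
    using inv r a geometric_error_convergence[OF r] geometric_error_convergence[OF a(1) a']
    by blast
qed

end
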